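(* Let $X=(\mathbb{R}^3,\|\cdot\|)$ be a three-dimensional Banach space with unit ball $B_X$. If $\beta_X(B_X,8)<\frac{221}{328}$, then $\beta(X,8)<1$.
   Context: All spaces are real. For $X=(\mathbb{R}^n,\|\cdot\|)$ and a nonempty bounded set $A\subset\mathbb{R}^n$, $\delta(A)=\sup\{\|x-y\| : x,y\in A\}$ is the diameter of $A$ in $X$. Let $\mathcal{B}^n$ be the family of all bounded subsets of $\mathbb{R}^n$ with positive diameter. For a positive integer $m$ and $A\in\mathcal{B}^n$, $$\beta_X(A,m)=\inf\left\{\frac{1}{\delta(A)}\max_{1\leq k\leq m}\delta(A_k) : A=\bigcup_{k=1}^m A_k\right\},$$ where the empty set, if it occurs among the $A_k$, is given diameter $0$. Put $\beta(X,m)=\sup\{\beta_X(A,m) : A\in\mathcal{B}^n\}$. *)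

theory Defs
  imports "HOL-Analysis.Analysis"
begin

text \<open>
  The type class norm on \<^typ>\<open>real ^ 'n\<close> is the Euclidean one.  An arbitrary norm on this space is
  therefore an explicit function \<open>N\<close>, and the normed space \<open>X\<close> is represented by \<open>N\<close>.
\<close>

definition is_norm :: "(real ^ 'n \<Rightarrow> real) \<Rightarrow> bool" where
  "is_norm N \<longleftrightarrow>
     (\<forall>x. 0 \<le> N x) \<and>
     (\<forall>x. N x = 0 \<longleftrightarrow> x = 0) \<and>
     (\<forall>c x. N (c *\<^sub>R x) = \<bar>c\<bar> * N x) \<and>
     (\<forall>x y. N (x + y) \<le> N x + N y)"

definition unit_ball :: "(real ^ 'n \<Rightarrow> real) \<Rightarrow> (real ^ 'n) set" where
  "unit_ball N = {x. N x \<le> 1}"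

definition diam :: "(real ^ 'n \<Rightarrow> real) \<Rightarrow> (real ^ 'n) set \<Rightarrow> real" where
  "diam N A = (if A = {} then 0 else Sup {N (x - y) | x y. x \<in> A \<and> y \<in> A})"

text \<open>
  The library predicate \<^const>\<open>bounded\<close> refers to the Euclidean norm; all norms on \<^typ>\<open>real ^ 'n\<close>
  have the same bounded sets.
\<close>

definition bounded_pos_diam :: "(real ^ 'n \<Rightarrow> real) \<Rightarrow> (real ^ 'n) set set" where
  "bounded_pos_diam N = {A. bounded A \<and> 0 < diam N A}"

text \<open>
  For \<open>1 \<le> m\<close>, a norm \<open>N\<close> and \<open>A \<in> bounded_pos_diam N\<close>, the infimum is over a nonempty set of
  nonnegative reals containing 1 (cover \<open>A\<close> by itself and empty sets).  So the infimum lies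
  between 0 and 1, and so does the supremum in \<open>beta\<close>.
\<close>

definition beta_set :: "(real ^ 'n \<Rightarrow> real) \<Rightarrow> (real ^ 'n) set \<Rightarrow> nat \<Rightarrow> real" where
  "beta_set N A m =
     Inf {1 / diam N A * Max ((\<lambda>k. diam N (P k)) ` {1..m}) | P :: nat \<Rightarrow> (real ^ 'n) set.
            A = (\<Union>k\<in>{1..m}. P k)}"

definition beta :: "(real ^ 'n \<Rightarrow> real) \<Rightarrow> nat \<Rightarrow> real" where
  "beta N m = Sup {beta_set N A m | A. A \<in> bounded_pos_diam N}"

end

theory Submission
  imports Defs
begin

text \<open>
  Let \<open>A\<close> have diameter \<open>d\<close>.  If \<open>A\<close> lies in a ball of radius \<open>r = (164/221) d\<close>, then a scaled copy of
  a good cover of the unit ball covers \<open>A\<close>: pieces of diameter \<open>2 q\<close> become pieces of diameter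
  \<open>2 q r\<close>, which is below \<open>d\<close> by a fixed factor because \<open>q < 221/328\<close>.

  Otherwise \<open>A\<close> is close to the vertices of a tetrahedron, and a tetrahedron is easy to divide.  By
  Helly's theorem, four points \<open>a\<^sub>1, \<dots>, a\<^sub>4\<close> of \<open>A\<close> already lie in no ball of radius \<open>r\<close>; equivalently,
  the balls of radius \<open>r\<close> around them have no common point.  Separating the product of these balls
  from the diagonal of the fourfold product space gives functionals \<open>f\<^sub>i\<close> with
  \<open>\<Sum> f\<^sub>i = 0\<close> and \<open>r \<Sum> \<parallel>f\<^sub>i\<parallel> < \<Sum> f\<^sub>i(a\<^sub>i)\<close> (dual norms).  The functions
  \<open>u\<^sub>i(x) = f\<^sub>i(x - a\<^sub>i) + \<parallel>f\<^sub>i\<parallel> d\<close> are nonnegative on \<open>A\<close>, since \<open>A\<close> has diameter \<open>d\<close>, and have a constant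
  sum \<open>S\<close>.  Thus \<open>w\<^sub>i = u\<^sub>i / S\<close> are the barycentric coordinates of a simplex that contains \<open>A\<close>.  The
  values \<open>w\<^sub>j(a\<^sub>j)\<close> are at most 1 and add up to more than \<open>d / (d - r) = 221/57\<close>, so each exceeds
  \<open>50/57 = 1 - \<epsilon>\<close> with \<open>\<epsilon> = 7/57\<close>: each \<open>a\<^sub>j\<close> is almost a vertex.

  The points \<open>a\<^sub>j\<close> have mutual distances at most \<open>d\<close>, and the matrix \<open>(w\<^sub>i(a\<^sub>j))\<close> is so close to the identity
  that the norm of \<open>x - y\<close> is at most \<open>d / (1 - 2 \<epsilon>) = (57/43) d\<close> times half of the \<open>\<ell>\<^sub>1\<close> distance of
  the coordinates of \<open>x\<close> and \<open>y\<close> (\<open>norm_le_barycentric_l1\<close>).  Some coordinate of each point is at least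
  \<open>1/4\<close>, and two points of \<open>A\<close> for which this is the same coordinate have half \<open>\<ell>\<^sub>1\<close> distance at most
  \<open>3/4\<close>.  So four pieces of diameter \<open>(3/4) (57/43) d = (171/172) d\<close> suffice in this case.
\<close>

section \<open>Norms on coordinate space\<close>

lemma is_norm_nonneg: "is_norm N \<Longrightarrow> 0 \<le> N x"
  and is_norm_eq_0_iff: "is_norm N \<Longrightarrow> N x = 0 \<longleftrightarrow> x = 0"
  and is_norm_scaleR: "is_norm N \<Longrightarrow> N (c *\<^sub>R x) = \<bar>c\<bar> * N x"
  and is_norm_triangle: "is_norm N \<Longrightarrow> N (x + y) \<le> N x + N y"
  by (auto simp: is_norm_def)

lemma is_norm_minus:
  assumes "is_norm N"
  shows "N (- x) = N x"
  using is_norm_scaleR[OF assms, of "-1" x] by simp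

lemma is_norm_minus_commute:
  assumes "is_norm N"
  shows "N (x - y) = N (y - x)"
  using is_norm_minus[OF assms, of "x - y"] by simp

lemma is_norm_zero:
  assumes "is_norm N"
  shows "N 0 = 0"
  using is_norm_eq_0_iff[OF assms] by simp

lemma is_norm_sum_le:
  assumes "is_norm N"
  shows "N (\<Sum>i\<in>I. f i) \<le> (\<Sum>i\<in>I. N (f i))"
proof (induction I rule: infinite_finite_induct)
  case (insert i I)
  then show ?case
    using is_norm_triangle[OF assms, of "f i" "\<Sum>i\<in>I. f i"] by simp
qed (simp_all add: is_norm_zero[OF assms])

lemma is_norm_convex_on:
  assumes "is_norm N"
  shows "convex_on UNIV N"
proof (intro convex_onI)
  fix t :: real and x y
  assume "0 < t" "t < 1"
  then show "N ((1 - t) *\<^sub>R x + t *\<^sub>R y) \<le> (1 - t) * N x + t * N y"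
    using is_norm_triangle[OF assms, of "(1 - t) *\<^sub>R x" "t *\<^sub>R y"]
    by (simp add: is_norm_scaleR[OF assms])
qed auto

lemma is_norm_continuous_on:
  assumes "is_norm N"
  shows "continuous_on S N"
  using convex_on_continuous[OF open_UNIV is_norm_convex_on[OF assms]]
  by (rule continuous_on_subset) simp

lemma is_norm_ge_norm:
  fixes N :: "real ^ 'n \<Rightarrow> real"
  assumes "is_norm N"
  obtains C where "0 < C" "\<And>x. norm x \<le> C * N x"
proof -
  \<comment> \<open>The least value of \<open>N\<close> on the Euclidean unit sphere is attained, hence positive.\<close>
  obtain s :: "real ^ 'n" where s: "s \<in> sphere 0 1" "\<And>x. x \<in> sphere 0 1 \<Longrightarrow> N s \<le> N x"
    using continuous_attains_inf[OF compact_sphere _ is_norm_continuous_on[OF assms], of 0 1]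
    by auto
  have "s \<noteq> 0"
    using s(1) by auto
  then have pos: "0 < N s"
    using is_norm_nonneg[OF assms, of s] is_norm_eq_0_iff[OF assms, of s] by linarith
  have "norm x \<le> (1 / N s) * N x" for x
  proof (cases "x = 0")
    case False
    have "N s \<le> N ((1 / norm x) *\<^sub>R x)"
      by (rule s(2)) (use False in simp)
    also have "\<dots> = N x / norm x"
      by (simp add: is_norm_scaleR[OF assms])
    finally show ?thesis
      using False pos by (simp add: field_simps)
  qed (simp add: is_norm_zero[OF assms])
  then show ?thesis
    using pos by (intro that[of "1 / N s"]) auto
qed

lemma is_norm_bounded_on:
  fixes N :: "real ^ 'n \<Rightarrow> real"
  assumes "is_norm N" "bounded A"
  obtains C where "\<And>x. x \<in> A \<Longrightarrow> N x \<le> C"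
proof -
  have "compact (N ` closure A)"
    using assms(2) by (intro compact_continuous_image is_norm_continuous_on[OF assms(1)]) simp
  then obtain C where "\<And>y. y \<in> N ` closure A \<Longrightarrow> norm y \<le> C"
    by (meson bounded_iff compact_imp_bounded)
  then show ?thesis
    using closure_subset[of A] by (intro that[of C]) fastforce
qed

definition norm_ball :: "(real ^ 'n \<Rightarrow> real) \<Rightarrow> real ^ 'n \<Rightarrow> real \<Rightarrow> (real ^ 'n) set" where
  "norm_ball N a r = {x. N (x - a) \<le> r}"

lemma convex_norm_ball:
  assumes "is_norm N"
  shows "convex (norm_ball N a r)"
proof -
  have "convex {x. N x \<le> r}"
  proof (rule convexI)
    fix x y and u v :: real
    assume *: "x \<in> {x. N x \<le> r}" "y \<in> {x. N x \<le> r}" "0 \<le> u" "0 \<le> v" "u + v = 1"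
    have "N (u *\<^sub>R x + v *\<^sub>R y) \<le> u * N x + v * N y"
      using is_norm_triangle[OF assms, of "u *\<^sub>R x" "v *\<^sub>R y"] *
      by (simp add: is_norm_scaleR[OF assms])
    also have "\<dots> \<le> r"
      using * by (intro convex_bound_le) auto
    finally show "u *\<^sub>R x + v *\<^sub>R y \<in> {x. N x \<le> r}"
      by simp
  qed
  moreover have "norm_ball N a r = (+) a ` {x. N x \<le> r}"
  proof
    show "norm_ball N a r \<subseteq> (+) a ` {x. N x \<le> r}"
    proof
      fix x assume "x \<in> norm_ball N a r"
      then show "x \<in> (+) a ` {x. N x \<le> r}"
        by (intro image_eqI[of _ _ "x - a"]) (simp_all add: norm_ball_def)
    qed
  qed (auto simp: norm_ball_def)
  ultimately show ?thesis
    by (simp add: convex_translation)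
qed

lemma bounded_norm_ball:
  assumes "is_norm N"
  shows "bounded (norm_ball N a r)"
proof -
  obtain C where C: "0 < C" "\<And>x. norm x \<le> C * N x"
    using is_norm_ge_norm[OF assms] by blast
  have "dist a x \<le> C * r" if "N (x - a) \<le> r" for x
    unfolding dist_norm norm_minus_commute[of a x]
    using C(2)[of "x - a"] mult_left_mono[OF that, of C] C(1) by linarith
  then show ?thesis
    unfolding norm_ball_def bounded_def by blast
qed

lemma compact_norm_ball:
  assumes "is_norm N"
  shows "compact (norm_ball N a r)"
proof -
  have "closed (norm_ball N a r)"
    unfolding norm_ball_def
    by (intro closed_Collect_le continuous_intros continuous_on_compose2[OF is_norm_continuous_on[OF assms, of UNIV]]) auto
  then show ?thesis
    using bounded_norm_ball[OF assms] by (simp add: compact_eq_bounded_closed)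
qed

section \<open>Diameters and covers\<close>

text \<open>
  The supremum in \<^const>\<open>diam\<close> is a conditional one and bounds the distances only because
  \<open>N\<close> is bounded on Euclidean bounded sets.
\<close>

lemma diam_upper:
  assumes "is_norm N" "bounded A" "x \<in> A" "y \<in> A"
  shows "N (x - y) \<le> diam N A"
proof -
  obtain C where C: "\<And>x. x \<in> A \<Longrightarrow> N x \<le> C"
    using is_norm_bounded_on[OF assms(1,2)] by blast
  have "N (u - v) \<le> C + C" if "u \<in> A" "v \<in> A" for u v
    using is_norm_triangle[OF assms(1), of u "- v"] is_norm_minus[OF assms(1), of v]
      C[OF that(1)] C[OF that(2)] by simp
  then have "bdd_above {N (x - y) | x y. x \<in> A \<and> y \<in> A}"
    by (intro bdd_aboveI[of _ "C + C"]) auto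
  then show ?thesis
    using assms(3,4) unfolding diam_def by (auto intro!: cSup_upper)
qed

lemma diam_least:
  assumes "0 \<le> D" "\<And>x y. x \<in> A \<Longrightarrow> y \<in> A \<Longrightarrow> N (x - y) \<le> D"
  shows "diam N A \<le> D"
proof (cases "A = {}")
  case False
  then have "{N (x - y) | x y. x \<in> A \<and> y \<in> A} \<noteq> {}"
    by blast
  then show ?thesis
    using assms False unfolding diam_def by (auto simp del: Collect_empty_eq intro!: cSup_least)
qed (use assms in \<open>simp add: diam_def\<close>)

lemma diam_nonneg:
  assumes "is_norm N" "bounded A"
  shows "0 \<le> diam N A"
proof (cases "A = {}")
  case False
  then obtain x where "x \<in> A" by blast
  then show ?thesis
    using diam_upper[OF assms, of x x] is_norm_zero[OF assms(1)] by simp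
qed (simp add: diam_def)

lemma beta_set_le:
  fixes P :: "nat \<Rightarrow> (real ^ 'n) set"
  assumes N: "is_norm N" and A: "A \<in> bounded_pos_diam N" and m: "1 \<le> m"
    and cover: "A = (\<Union>k\<in>{1..m}. P k)" and q: "0 \<le> q"
    and small: "\<And>k x y. k \<in> {1..m} \<Longrightarrow> x \<in> P k \<Longrightarrow> y \<in> P k \<Longrightarrow> N (x - y) \<le> q * diam N A"
  shows "beta_set N A m \<le> q"
proof -
  let ?V = "{1 / diam N A * Max ((\<lambda>k. diam N (P k)) ` {1..m}) | P :: nat \<Rightarrow> (real ^ 'n) set.
            A = (\<Union>k\<in>{1..m}. P k)}"
  have bA: "bounded A" and pos: "0 < diam N A"
    using A by (auto simp: bounded_pos_diam_def)
  have "0 \<le> v" if "v \<in> ?V" for v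
    using that
  proof (elim CollectE exE conjE)
    fix Q :: "nat \<Rightarrow> (real ^ 'n) set"
    assume Q: "A = (\<Union>k\<in>{1..m}. Q k)" "v = 1 / diam N A * Max ((\<lambda>k. diam N (Q k)) ` {1..m})"
    have "bounded (Q 1)"
      using bA Q(1) m by (intro bounded_subset[OF bA]) auto
    then have "0 \<le> diam N (Q 1)"
      by (rule diam_nonneg[OF N])
    also have "\<dots> \<le> Max ((\<lambda>k. diam N (Q k)) ` {1..m})"
      using m by (intro Max_ge) auto
    finally show "0 \<le> v"
      using pos Q(2) by simp
  qed
  then have "bdd_below ?V"
    by (rule bdd_belowI)
  then have "beta_set N A m \<le> 1 / diam N A * Max ((\<lambda>k. diam N (P k)) ` {1..m})"
    unfolding beta_set_def using cover by (intro cInf_lower) blast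
  also have "Max ((\<lambda>k. diam N (P k)) ` {1..m}) \<le> q * diam N A"
    using m q pos small by (intro Max.boundedI) (auto intro!: diam_least)
  then have "1 / diam N A * Max ((\<lambda>k. diam N (P k)) ` {1..m}) \<le> q"
    using pos by (simp add: field_simps)
  finally show ?thesis .
qed

lemma beta_set_less_cover:
  fixes A :: "(real ^ 'n) set"
  assumes N: "is_norm N" and A: "A \<in> bounded_pos_diam N" and m: "1 \<le> m"
    and less: "beta_set N A m < b"
  obtains P q where "0 \<le> q" "q < b" "A = (\<Union>k\<in>{1..m}. P k)"
    "\<And>k x y. k \<in> {1..m} \<Longrightarrow> x \<in> P k \<Longrightarrow> y \<in> P k \<Longrightarrow> N (x - y) \<le> q * diam N A"
proof -
  let ?V = "{1 / diam N A * Max ((\<lambda>k. diam N (P k)) ` {1..m}) | P :: nat \<Rightarrow> (real ^ 'n) set.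
            A = (\<Union>k\<in>{1..m}. P k)}"
  have bA: "bounded A" and pos: "0 < diam N A"
    using A by (auto simp: bounded_pos_diam_def)
  have "A = (\<Union>k\<in>{1..m}. (\<lambda>_. A) k)"
    using m by auto
  then have ne: "?V \<noteq> {}"
    by blast
  have "Inf ?V < b"
    using less by (simp only: beta_set_def)
  from cInf_lessD[OF ne this] obtain P :: "nat \<Rightarrow> (real ^ 'n) set" where P: "A = (\<Union>k\<in>{1..m}. P k)"
    "1 / diam N A * Max ((\<lambda>k. diam N (P k)) ` {1..m}) < b"
    by auto
  define q where "q = 1 / diam N A * Max ((\<lambda>k. diam N (P k)) ` {1..m})"
  have bP: "bounded (P k)" if "k \<in> {1..m}" for k
    by (rule bounded_subset[OF bA]) (use that P(1) in auto)
  have le: "diam N (P k) \<le> q * diam N A" if "k \<in> {1..m}" for k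
    using that pos by (auto simp: q_def intro!: Max_ge)
  have "0 \<le> q * diam N A"
    using diam_nonneg[OF N bP, of 1] le[of 1] m by auto
  then have "0 \<le> q"
    using pos by (simp add: zero_le_mult_iff)
  moreover have "q < b"
    using P(2) by (simp only: q_def)
  moreover have "N (x - y) \<le> q * diam N A" if "k \<in> {1..m}" "x \<in> P k" "y \<in> P k" for k x y
    using diam_upper[OF N bP that(2,3)] le that(1) by fastforce
  ultimately show ?thesis
    using P(1) that by blast
qed

lemma unit_ball_bounded_pos_diam:
  fixes N :: "real ^ 'n \<Rightarrow> real"
  assumes "is_norm N"
  shows "unit_ball N \<in> bounded_pos_diam N" and "diam N (unit_ball N) \<le> 2"
proof -
  have eq: "unit_ball N = norm_ball N 0 1"
    by (simp add: unit_ball_def norm_ball_def)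
  have bdd: "bounded (unit_ball N)"
    unfolding eq by (rule bounded_norm_ball[OF assms])
  define u :: "real ^ 'n" where "u = (\<chi> i. 1)"
  have "u \<noteq> 0"
    by (simp add: u_def vec_eq_iff)
  then have u: "0 < N u"
    using is_norm_nonneg[OF assms, of u] is_norm_eq_0_iff[OF assms, of u] by linarith
  define v where "v = (1 / N u) *\<^sub>R u"
  have v: "N v = 1"
    using u by (simp add: v_def is_norm_scaleR[OF assms])
  have "N (v - 0) \<le> diam N (unit_ball N)"
    by (rule diam_upper[OF assms bdd]) (simp_all add: unit_ball_def v is_norm_zero[OF assms])
  then show "unit_ball N \<in> bounded_pos_diam N"
    using bdd v by (simp add: bounded_pos_diam_def)
  show "diam N (unit_ball N) \<le> 2"
  proof (rule diam_least)
    fix x y assume "x \<in> unit_ball N" "y \<in> unit_ball N"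
    then show "N (x - y) \<le> 2"
      using is_norm_triangle[OF assms, of x "- y"] is_norm_minus[OF assms, of y]
      by (simp add: unit_ball_def)
  qed simp
qed

text \<open>
  The homothety that takes the circumscribed ball to the unit ball pulls a cover of the unit ball
  back to a cover of \<open>A\<close>.  The factor 2 is the bound for the diameter of the unit ball.
\<close>

lemma beta_set_le_of_circumscribed_ball:
  fixes N :: "real ^ 'n \<Rightarrow> real"
  assumes N: "is_norm N" and A: "A \<in> bounded_pos_diam N" and m: "1 \<le> m" and q: "0 \<le> q"
    and ball: "unit_ball N = (\<Union>k\<in>{1..m}. P k)"
    and small: "\<And>k x y. k \<in> {1..m} \<Longrightarrow> x \<in> P k \<Longrightarrow> y \<in> P k \<Longrightarrow> N (x - y) \<le> 2 * q"
    and r: "0 < r" and sub: "A \<subseteq> norm_ball N c (r * diam N A)"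
  shows "beta_set N A m \<le> 2 * r * q"
proof -
  define R where "R = r * diam N A"
  have R: "0 < R"
    using A r by (simp add: R_def bounded_pos_diam_def)
  let ?s = "\<lambda>x. (1 / R) *\<^sub>R (x - c)"
  define Q where "Q k = {x \<in> A. ?s x \<in> P k}" for k
  show ?thesis
  proof (rule beta_set_le[OF N A m, of Q])
    have "?s x \<in> unit_ball N" if "x \<in> A" for x
      using that sub R by (auto simp: unit_ball_def norm_ball_def is_norm_scaleR[OF N] R_def)
    then show "A = (\<Union>k\<in>{1..m}. Q k)"
      unfolding ball Q_def by blast
    show "0 \<le> 2 * r * q"
      using r q by simp
    fix k x y assume *: "k \<in> {1..m}" "x \<in> Q k" "y \<in> Q k"
    have "?s x - ?s y = (1 / R) *\<^sub>R (x - y)"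
      by (simp add: algebra_simps)
    then have "N (x - y) / R = N (?s x - ?s y)"
      using R by (simp add: is_norm_scaleR[OF N])
    also have "\<dots> \<le> 2 * q"
      using * by (intro small) (auto simp: Q_def)
    finally show "N (x - y) \<le> 2 * r * q * diam N A"
      using R by (simp add: R_def field_simps)
  qed
qed

section \<open>Few points that fit into no smaller ball\<close>

text \<open>
  Helly's theorem treats finite families and compactness passes to arbitrary ones.  The members to
  be tested are indexed by a type with \<open>DIM('a) + 1\<close> elements, with repetitions allowed.  This also
  covers families that are too small for Helly's theorem, and it provides the index type of the
  product space in the next lemma.
\<close>

lemma Helly_compact_family:
  fixes K :: "'b \<Rightarrow> 'a::euclidean_space set"
  assumes card: "CARD('m::finite) = DIM('a) + 1"
    and convex: "\<And>a. a \<in> A \<Longrightarrow> convex (K a)" and compact: "\<And>a. a \<in> A \<Longrightarrow> compact (K a)"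
    and few: "\<And>f :: 'm \<Rightarrow> 'b. range f \<subseteq> A \<Longrightarrow> (\<Inter>i. K (f i)) \<noteq> {}"
  shows "(\<Inter>a\<in>A. K a) \<noteq> {}"
proof -
  have small: "\<Inter>T \<noteq> {}" if T: "T \<subseteq> K ` A" "finite T" "card T \<le> DIM('a) + 1" for T
  proof (cases "T = {}")
    case False
    have "\<exists>f. inj_on f T \<and> f ` T \<subseteq> (UNIV :: 'm set)"
      using card_le_inj[OF T(2) finite_class.finite_UNIV] T(3) card by metis
    then obtain h :: "'m \<Rightarrow> 'a set" where h: "range h = T"
      using inj_on_iff_surj[OF False] by metis
    then have "\<forall>i. \<exists>a. a \<in> A \<and> K a = h i"
      using T(1) by blast
    then obtain f where f: "\<And>i. f i \<in> A" "\<And>i. K (f i) = h i"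
      by metis
    then have "(\<Inter>i. K (f i)) = \<Inter>T"
      using h by simp
    then show ?thesis
      using few[of f] f(1) by auto
  qed simp
  have "\<Inter>(K ` A) \<noteq> {}"
  proof (rule compact_fip_Heine_Borel)
    fix F assume F: "finite F" "F \<subseteq> K ` A"
    show "\<Inter>F \<noteq> {}"
    proof (cases "card F \<ge> DIM('a) + 1")
      case True
      then show ?thesis
      proof (rule Helly)
        show "\<forall>s\<in>F. convex s"
          using F convex by blast
        show "\<Inter>t \<noteq> {}" if "t \<subseteq> F" "card t = DIM('a) + 1" for t
          using that F by (intro small) (auto intro: finite_subset)
      qed
    next
      case False
      then show ?thesis
        using F by (intro small) auto
    qed
  qed (use compact in auto)
  then show ?thesis by simp
qed

text \<open>
  A duality certificate for the empty intersection.  A common point of the balls would be a point of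
  the diagonal of \<^typ>\<open>real ^ 'n ^ 'm\<close> in the product of the balls.  The product is compact and convex, so
  a hyperplane separates it from the diagonal; the components of its normal vector are the
  functionals \<open>g i\<close>.  They add up to 0 because the normal vector is orthogonal to the diagonal, and
  \<open>M i\<close> is the dual norm of \<open>g i\<close>.
\<close>

lemma separate_disjoint_balls:
  fixes N :: "real ^ 'n \<Rightarrow> real" and a :: "'m::finite \<Rightarrow> real ^ 'n"
  assumes N: "is_norm N" and r: "0 \<le> r" and disj: "(\<Inter>i. norm_ball N (a i) r) = {}"
  obtains g :: "'m \<Rightarrow> real ^ 'n" and M :: "'m \<Rightarrow> real"
  where "(\<Sum>i\<in>UNIV. g i) = 0" "\<And>i. 0 \<le> M i" "\<And>i x. g i \<bullet> x \<le> M i * N x"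
    "r * (\<Sum>i\<in>UNIV. M i) < (\<Sum>i\<in>UNIV. g i \<bullet> a i)"
proof -
  define S :: "(real ^ 'n ^ 'm) set" where "S = range (\<lambda>c. \<chi> i. c)"
  define T :: "(real ^ 'n ^ 'm) set" where "T = {x. \<forall>i. x $ i \<in> norm_ball N (a i) r}"
  have lin: "linear (\<lambda>c :: real ^ 'n. \<chi> i :: 'm. c)"
    by (intro linearI) (simp_all add: vec_eq_iff)
  have S: "subspace S"
    unfolding S_def by (rule linear_subspace_image[OF lin subspace_UNIV])
  have convT: "convex T"
    using convex_norm_ball[OF N] unfolding T_def convex_def by simp
  have "closed T"
    unfolding T_def using compact_norm_ball[OF N] by (intro closed_vector_box) (simp add: compact_imp_closed)
  moreover have "bounded T"
  proof -
    have "\<forall>i. \<exists>B. \<forall>x\<in>norm_ball N (a i) r. norm x \<le> B"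
      using bounded_norm_ball[OF N] unfolding bounded_iff by blast
    then obtain B where B: "\<And>i x. x \<in> norm_ball N (a i) r \<Longrightarrow> norm x \<le> B i"
      by metis
    have "norm x \<le> (\<Sum>i\<in>UNIV. B i)" if "x \<in> T" for x
    proof -
      have "norm x \<le> (\<Sum>i\<in>UNIV. norm (x $ i))"
        unfolding norm_vec_def by (rule L2_set_le_sum) simp
      also have "\<dots> \<le> (\<Sum>i\<in>UNIV. B i)"
        using that by (intro sum_mono B) (simp add: T_def)
      finally show ?thesis .
    qed
    then show ?thesis
      unfolding bounded_iff by blast
  qed
  ultimately have compT: "compact T"
    by (simp add: compact_eq_bounded_closed)
  have "(\<chi> i. a i) \<in> T"
    using r by (simp add: T_def norm_ball_def is_norm_zero[OF N])
  then have neT: "T \<noteq> {}" by blast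
  have "S \<inter> T = {}"
  proof (rule ccontr)
    assume "S \<inter> T \<noteq> {}"
    then obtain c where "(\<chi> i. c) \<in> T"
      unfolding S_def by blast
    then have "c \<in> (\<Inter>i. norm_ball N (a i) r)"
      by (simp add: T_def)
    then show False
      using disj by blast
  qed
  then obtain G b where G: "\<And>x. x \<in> S \<Longrightarrow> G \<bullet> x < b" "\<And>x. x \<in> T \<Longrightarrow> b < G \<bullet> x"
    using separating_hyperplane_closed_compact[OF subspace_imp_convex[OF S] closed_subspace[OF S] convT compT neT]
    by blast
  have b: "0 < b"
    using G(1)[OF subspace_0[OF S]] by simp
  have orth: "G \<bullet> x = 0" if "x \<in> S" for x
  proof (rule ccontr)
    assume "G \<bullet> x \<noteq> 0"
    then have "G \<bullet> ((b / (G \<bullet> x)) *\<^sub>R x) = b"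
      by simp
    then show False
      using G(1)[OF subspace_scale[OF S that, of "b / (G \<bullet> x)"]] by simp
  qed
  define g where "g i = G $ i" for i
  have G_inner: "G \<bullet> x = (\<Sum>i\<in>UNIV. g i \<bullet> x $ i)" for x
    unfolding g_def by (rule inner_vec_def)
  have "(\<Sum>i\<in>UNIV. g i) \<bullet> c = 0" for c
    using orth[of "\<chi> i. c"] by (simp add: S_def G_inner inner_sum_left)
  then have sum0: "(\<Sum>i\<in>UNIV. g i) = 0"
    by (metis inner_eq_zero_iff)
  have "\<exists>y\<in>norm_ball N 0 1. \<forall>z\<in>norm_ball N 0 1. g i \<bullet> z \<le> g i \<bullet> y" for i
  proof (rule continuous_attains_sup[OF compact_norm_ball[OF N]])
    have "0 \<in> norm_ball N 0 1"
      by (simp add: norm_ball_def is_norm_zero[OF N])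
    then show "norm_ball N 0 1 \<noteq> {}" by blast
  qed (intro continuous_intros)
  then obtain y where y: "\<And>i. N (y i) \<le> 1" "\<And>i z. N z \<le> 1 \<Longrightarrow> g i \<bullet> z \<le> g i \<bullet> y i"
    unfolding norm_ball_def by simp metis
  define M where "M i = g i \<bullet> y i" for i
  have M0: "0 \<le> M i" for i
    using y(2)[of 0 i] by (simp add: M_def is_norm_zero[OF N])
  have gM: "g i \<bullet> x \<le> M i * N x" for i x
  proof (cases "x = 0")
    case False
    then have pos: "0 < N x"
      using is_norm_nonneg[OF N, of x] is_norm_eq_0_iff[OF N, of x] by linarith
    then have "g i \<bullet> ((1 / N x) *\<^sub>R x) \<le> M i"
      unfolding M_def by (intro y(2)) (simp add: is_norm_scaleR[OF N])
    then show ?thesis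
      using pos by (simp add: field_simps)
  qed (simp add: is_norm_zero[OF N])
  \<comment> \<open>The point of the product at which the separating functional is smallest.\<close>
  have "(\<chi> i. a i - r *\<^sub>R y i) \<in> T"
  proof -
    have "N (a i - r *\<^sub>R y i - a i) \<le> r" for i
      using is_norm_scaleR[OF N, of "- r" "y i"] r mult_left_mono[OF y(1)[of i] r] by simp
    then show ?thesis
      by (simp add: T_def norm_ball_def)
  qed
  then have "b < (\<Sum>i\<in>UNIV. g i \<bullet> (a i - r *\<^sub>R y i))"
    using G(2)[of "\<chi> i. a i - r *\<^sub>R y i"] by (simp add: G_inner)
  also have "\<dots> = (\<Sum>i\<in>UNIV. g i \<bullet> a i) - r * (\<Sum>i\<in>UNIV. M i)"
    by (simp add: inner_diff_right sum_subtractf M_def sum_distrib_left)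
  finally have "r * (\<Sum>i\<in>UNIV. M i) < (\<Sum>i\<in>UNIV. g i \<bullet> a i)"
    using b by simp
  then show ?thesis
    using sum0 M0 gM that by blast
qed

text \<open>
  Each \<open>a j\<close> yields a half-space that contains \<open>A\<close>: the functional \<open>f j\<close> of the separation lemma, of
  dual norm \<open>M j\<close>, is at least \<open>f j \<bullet> a j - M j * d\<close> on \<open>A\<close>.  The slacks \<open>u j\<close> of these
  inequalities add up to a constant \<open>S\<close> because the \<open>f j\<close> add up to 0, and the quotients \<open>u j / S\<close> are
  the coordinates.  The slack of \<open>a j\<close> itself is \<open>M j * d\<close>; these slacks add up to \<open>d * L\<close>, which is
  large compared with \<open>S < (d - r) * L\<close>, while none of them exceeds \<open>S\<close>.  So none can be small.
\<close>

lemma barycentric_coordinates_of_wide_points: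
  fixes N :: "real ^ 'n \<Rightarrow> real" and a :: "'m::finite \<Rightarrow> real ^ 'n"
  assumes N: "is_norm N" and r: "0 \<le> r" "r < d"
    and disj: "(\<Inter>i. norm_ball N (a i) r) = {}"
    and a: "range a \<subseteq> A" and A: "\<And>x y. x \<in> A \<Longrightarrow> y \<in> A \<Longrightarrow> N (x - y) \<le> d"
  obtains g :: "'m \<Rightarrow> real ^ 'n" and h :: "'m \<Rightarrow> real"
  where "\<And>x. (\<Sum>i\<in>UNIV. g i \<bullet> x + h i) = 1" "\<And>i x. x \<in> A \<Longrightarrow> 0 \<le> g i \<bullet> x + h i"
    "\<And>j. d / (d - r) - (real CARD('m) - 1) \<le> g j \<bullet> a j + h j"
proof -
  obtain f :: "'m \<Rightarrow> real ^ 'n" and M :: "'m \<Rightarrow> real"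
    where f: "(\<Sum>i\<in>UNIV. f i) = 0" "\<And>i. 0 \<le> M i" "\<And>i x. f i \<bullet> x \<le> M i * N x"
    "r * (\<Sum>i\<in>UNIV. M i) < (\<Sum>i\<in>UNIV. f i \<bullet> a i)"
    using separate_disjoint_balls[OF N r(1) disj] by blast
  define u where "u i x = f i \<bullet> (x - a i) + M i * d" for i x
  define L where "L = (\<Sum>i\<in>UNIV. M i)"
  define S where "S = d * L - (\<Sum>i\<in>UNIV. f i \<bullet> a i)"
  have aA: "a i \<in> A" for i
    using a by blast
  have sum_u: "(\<Sum>i\<in>UNIV. u i x) = S" for x
  proof -
    have "(\<Sum>i\<in>UNIV. f i \<bullet> x) = 0"
      using f(1) by (simp flip: inner_sum_left)
    then show ?thesis
      by (simp add: u_def S_def L_def inner_diff_right sum.distrib sum_subtractf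
          sum_distrib_right sum_distrib_left mult.commute)
  qed
  have u_nonneg: "0 \<le> u i x" if "x \<in> A" for i x
  proof -
    have "f i \<bullet> (a i - x) \<le> M i * d"
      using f(3)[of i "a i - x"] mult_left_mono[OF A[OF aA that] f(2)[of i], of i] by linarith
    then show ?thesis
      by (simp add: u_def inner_diff_right)
  qed
  have u_diag: "u i (a i) = M i * d" for i
    by (simp add: u_def)
  have S_less: "S < (d - r) * L"
    using f(4) by (simp add: S_def L_def algebra_simps)
  have u_le: "u i x \<le> S" if "x \<in> A" for i x
    unfolding sum_u[of x, symmetric] by (rule member_le_sum) (auto intro: u_nonneg[OF that])
  have "0 \<le> S"
    unfolding sum_u[of "a undefined", symmetric] by (intro sum_nonneg u_nonneg aA)
  then have L: "0 < L"
    using S_less r by (smt (verit) zero_less_mult_pos mult_nonneg_nonpos)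
  have dL: "(\<Sum>i\<in>UNIV. u i (a i)) = d * L"
    by (simp add: u_diag L_def sum_distrib_left mult.commute)
  have S: "0 < S"
  proof (rule ccontr)
    assume "\<not> 0 < S"
    then have "(\<Sum>i\<in>UNIV. u i (a i)) \<le> 0"
      using u_le[OF aA] by (intro sum_nonpos) (meson linorder_not_le order_trans)
    then show False
      using dL L r by (smt (verit) mult_pos_pos)
  qed
  have diag: "d / (d - r) - (real CARD('m) - 1) \<le> u j (a j) / S" for j
  proof -
    have "d * L = u j (a j) + (\<Sum>i\<in>UNIV - {j}. u i (a i))"
      unfolding dL[symmetric] by (rule sum.remove) auto
    also have "(\<Sum>i\<in>UNIV - {j}. u i (a i)) \<le> (\<Sum>i\<in>UNIV - {j}. S)"
      by (intro sum_mono u_le aA)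
    also have "(\<Sum>i\<in>UNIV - {j}. S) = (real CARD('m) - 1) * S"
      by (simp add: card_Diff_singleton of_nat_diff)
    finally have "d * L / S \<le> u j (a j) / S + (real CARD('m) - 1)"
      using S by (simp add: field_simps)
    moreover have "d / (d - r) \<le> d * L / S"
    proof -
      have "d * S \<le> d * ((d - r) * L)"
        using S_less r by (intro mult_left_mono) auto
      then show ?thesis
        using S r by (simp add: field_simps)
    qed
    ultimately show ?thesis by simp
  qed
  define g where "g i = (1 / S) *\<^sub>R f i" for i
  define h where "h i = (M i * d - f i \<bullet> a i) / S" for i
  have gh: "g i \<bullet> x + h i = u i x / S" for i x
    using S by (simp add: g_def h_def u_def inner_diff_right field_simps)
  show ?thesis
  proof (rule that[of g h])
    show "(\<Sum>i\<in>UNIV. g i \<bullet> x + h i) = 1" for x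
      using S by (simp add: gh sum_u flip: sum_divide_distrib)
    show "0 \<le> g i \<bullet> x + h i" if "x \<in> A" for i x
      using u_nonneg[OF that] S by (simp add: gh)
    show "d / (d - r) - (real CARD('m) - 1) \<le> g j \<bullet> a j + h j" for j
      using diag by (simp add: gh)
  qed
qed

section \<open>Barycentric coordinates control the norm\<close>

text \<open>
  A column-stochastic matrix with diagonal entries at least \<open>1 - \<epsilon>\<close> differs from the identity by an operator
  of \<open>\<ell>\<^sub>1\<close> norm at most \<open>2 \<epsilon>\<close>: each column loses at most \<open>\<epsilon>\<close> on the diagonal and has at most \<open>\<epsilon>\<close> off it.
\<close>

lemma stochastic_matrix_l1_lower_bound:
  fixes W :: "'m::finite \<Rightarrow> 'm \<Rightarrow> real"
  assumes nonneg: "\<And>i j. 0 \<le> W i j" and sum1: "\<And>j. (\<Sum>i\<in>UNIV. W i j) = 1"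
    and diag: "\<And>j. 1 - \<epsilon> \<le> W j j"
  shows "(1 - 2 * \<epsilon>) * (\<Sum>j\<in>UNIV. \<bar>t j\<bar>) \<le> (\<Sum>i\<in>UNIV. \<bar>\<Sum>j\<in>UNIV. W i j * t j\<bar>)"
proof -
  have row: "2 * W i i * \<bar>t i\<bar> - (\<Sum>j\<in>UNIV. W i j * \<bar>t j\<bar>) \<le> \<bar>\<Sum>j\<in>UNIV. W i j * t j\<bar>" for i
  proof -
    have split: "(\<Sum>j\<in>UNIV. F j) = F i + (\<Sum>j\<in>UNIV - {i}. F j)" for F :: "'m \<Rightarrow> real"
      by (rule sum.remove) auto
    have "\<bar>\<Sum>j\<in>UNIV - {i}. W i j * t j\<bar> \<le> (\<Sum>j\<in>UNIV - {i}. W i j * \<bar>t j\<bar>)"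
      using nonneg by (intro order_trans[OF sum_abs]) (simp add: abs_mult)
    moreover have "\<bar>W i i * t i\<bar> = W i i * \<bar>t i\<bar>"
      using nonneg by (simp add: abs_mult)
    ultimately show ?thesis
      using split[of "\<lambda>j. W i j * t j"] split[of "\<lambda>j. W i j * \<bar>t j\<bar>"] by linarith
  qed
  have "(1 - 2 * \<epsilon>) * (\<Sum>j\<in>UNIV. \<bar>t j\<bar>) \<le> (\<Sum>j\<in>UNIV. (2 * W j j - 1) * \<bar>t j\<bar>)"
    unfolding sum_distrib_left
  proof (intro sum_mono mult_right_mono)
    show "1 - 2 * \<epsilon> \<le> 2 * W j j - 1" for j
      using diag[of j] by simp
  qed simp
  also have "\<dots> = (\<Sum>j\<in>UNIV. 2 * W j j * \<bar>t j\<bar>) - (\<Sum>j\<in>UNIV. (\<Sum>i\<in>UNIV. W i j) * \<bar>t j\<bar>)"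
    by (simp add: sum1 algebra_simps sum_subtractf)
  also have "(\<Sum>j\<in>UNIV. (\<Sum>i\<in>UNIV. W i j) * \<bar>t j\<bar>) = (\<Sum>i\<in>UNIV. \<Sum>j\<in>UNIV. W i j * \<bar>t j\<bar>)"
    unfolding sum_distrib_right by (rule sum.swap)
  also have "(\<Sum>j\<in>UNIV. 2 * W j j * \<bar>t j\<bar>) - \<dots>
      = (\<Sum>i\<in>UNIV. 2 * W i i * \<bar>t i\<bar> - (\<Sum>j\<in>UNIV. W i j * \<bar>t j\<bar>))"
    by (simp add: sum_subtractf)
  also have "\<dots> \<le> (\<Sum>i\<in>UNIV. \<bar>\<Sum>j\<in>UNIV. W i j * t j\<bar>)"
    by (intro sum_mono row)
  finally show ?thesis .
qed

text \<open>
  Let \<open>s\<close> be the common sum of the positive parts \<open>p i\<close> and of the negative parts \<open>q i\<close> of the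
  coefficients.  Pairing every positive part with every negative part writes the combination as
  \<open>1 / s\<close> times the sum of \<open>p i * q j\<close> times the differences \<open>a i - a j\<close>.
\<close>

lemma norm_balanced_combination_le:
  fixes N :: "real ^ 'n \<Rightarrow> real" and a :: "'m::finite \<Rightarrow> real ^ 'n"
  assumes N: "is_norm N" and t: "(\<Sum>i\<in>UNIV. t i) = 0" and a: "\<And>i j. N (a i - a j) \<le> d"
  shows "N (\<Sum>i\<in>UNIV. t i *\<^sub>R a i) \<le> d / 2 * (\<Sum>i\<in>UNIV. \<bar>t i\<bar>)"
proof -
  define p where "p i = (\<bar>t i\<bar> + t i) / 2" for i
  define q where "q i = (\<bar>t i\<bar> - t i) / 2" for i
  define s where "s = (\<Sum>i\<in>UNIV. \<bar>t i\<bar>) / 2"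
  have pq: "0 \<le> p i" "0 \<le> q i" "t i = p i - q i" for i
    by (auto simp: p_def q_def field_simps)
  have sp: "(\<Sum>i\<in>UNIV. p i) = s" and sq: "(\<Sum>i\<in>UNIV. q i) = s"
    using t by (simp_all add: p_def q_def s_def sum.distrib sum_subtractf flip: sum_divide_distrib)
  have s: "0 \<le> s"
    by (simp add: s_def sum_nonneg)
  show ?thesis
  proof (cases "s = 0")
    case True
    then have "t i = 0" for i
      by (simp add: s_def sum_nonneg_eq_0_iff)
    then show ?thesis
      by (simp add: is_norm_zero[OF N])
  next
    case False
    have "s *\<^sub>R (\<Sum>i\<in>UNIV. t i *\<^sub>R a i) = (\<Sum>i\<in>UNIV. \<Sum>j\<in>UNIV. (p i * q j) *\<^sub>R (a i - a j))"
    proof -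
      have "(\<Sum>i\<in>UNIV. \<Sum>j\<in>UNIV. (p i * q j) *\<^sub>R a i) = s *\<^sub>R (\<Sum>i\<in>UNIV. p i *\<^sub>R a i)"
        unfolding sq[symmetric]
        by (simp add: scaleR_sum_left scaleR_sum_right sum_distrib_left mult.commute
            flip: scaleR_sum_left)
      moreover have "(\<Sum>i\<in>UNIV. \<Sum>j\<in>UNIV. (p i * q j) *\<^sub>R a j) = s *\<^sub>R (\<Sum>j\<in>UNIV. q j *\<^sub>R a j)"
        unfolding sp[symmetric] by (subst sum.swap) (simp add: scaleR_sum_left scaleR_sum_right
            flip: scaleR_sum_left sum_distrib_right)
      ultimately show ?thesis
        by (simp add: pq(3) scaleR_diff_right scaleR_diff_left sum_subtractf)
    qed
    then have "s * N (\<Sum>i\<in>UNIV. t i *\<^sub>R a i) = N (\<Sum>i\<in>UNIV. \<Sum>j\<in>UNIV. (p i * q j) *\<^sub>R (a i - a j))"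
      using is_norm_scaleR[OF N, of s] s by (metis abs_of_nonneg)
    also have "\<dots> \<le> (\<Sum>i\<in>UNIV. \<Sum>j\<in>UNIV. N ((p i * q j) *\<^sub>R (a i - a j)))"
      by (intro order_trans[OF is_norm_sum_le[OF N]] sum_mono is_norm_sum_le[OF N])
    also have "\<dots> \<le> (\<Sum>i\<in>UNIV. \<Sum>j\<in>UNIV. p i * q j * d)"
      using pq a by (intro sum_mono) (simp add: is_norm_scaleR[OF N] abs_mult mult_left_mono)
    also have "\<dots> = s * (s * d)"
      by (simp add: sp sq mult.assoc flip: sum_distrib_left sum_distrib_right)
    finally have "N (\<Sum>i\<in>UNIV. t i *\<^sub>R a i) \<le> s * d"
      using s False by simp
    then show ?thesis
      by (simp add: s_def mult.commute)
  qed
qed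

text \<open>
  Affinely independent points whose number exceeds the dimension by one span the space affinely.
  The proof counts dimensions for the hyperplane of coefficient vectors with sum 0.  The conclusion
  of the independence hypothesis is in terms of the \<open>\<ell>\<^sub>1\<close> norm because this is what the matrix estimate
  controls.
\<close>

lemma balanced_combinations_span:
  fixes a :: "'m::finite \<Rightarrow> real ^ 'n"
  assumes card: "CARD('m) = CARD('n) + 1"
    and indep: "\<And>t. (\<Sum>i\<in>UNIV. t i) = 0 \<Longrightarrow> (\<Sum>i\<in>UNIV. t i *\<^sub>R a i) = 0 \<Longrightarrow> (\<Sum>i\<in>UNIV. \<bar>t i\<bar>) = 0"
  obtains t where "(\<Sum>i\<in>UNIV. t i) = 0" "z = (\<Sum>i\<in>UNIV. t i *\<^sub>R a i)"
proof -
  define H :: "(real ^ 'm) set" where "H = {t. (\<chi> i. 1) \<bullet> t = 0}"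
  define F where "F t = (\<Sum>i\<in>UNIV. t $ i *\<^sub>R a i)" for t :: "real ^ 'm"
  have H: "t \<in> H \<longleftrightarrow> (\<Sum>i\<in>UNIV. t $ i) = 0" for t
    by (simp add: H_def inner_vec_def)
  have sub: "subspace H"
    unfolding H_def by (rule subspace_hyperplane)
  have lin: "linear F"
    by (intro linearI) (simp_all add: F_def scaleR_add_left sum.distrib scaleR_sum_right)
  have "t = 0" if "t \<in> H" "F t = 0" for t
  proof -
    have "(\<Sum>i\<in>UNIV. \<bar>t $ i\<bar>) = 0"
      using that by (intro indep) (simp_all add: H F_def)
    then show ?thesis
      by (simp add: sum_nonneg_eq_0_iff vec_eq_iff)
  qed
  then have "inj_on F (span H)"
    unfolding span_eq_iff[THEN iffD2, OF sub] using linear_inj_on_iff_eq_0[OF lin sub] by blast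
  then have "dim (F ` H) = dim H"
    by (rule dim_image_eq[OF lin])
  also have "\<dots> = DIM(real ^ 'm) - 1"
    unfolding H_def by (rule dim_hyperplane) (simp add: vec_eq_iff)
  finally have "dim (F ` H) = DIM(real ^ 'n)"
    using card by simp
  then have "span (F ` H) = UNIV"
    by (simp only: dim_eq_full)
  moreover have "subspace (F ` H)"
    by (rule linear_subspace_image[OF lin sub])
  ultimately have "z \<in> F ` H"
    by (metis UNIV_I span_eq_iff)
  then show ?thesis
    using that by (auto simp: H F_def)
qed

text \<open>
  Write \<open>z\<close> as a combination of the points \<open>a j\<close> with coefficients \<open>t j\<close> that add up to 0.  The coordinate
  differences \<open>g i \<bullet> z\<close> arise from \<open>t\<close> by the almost diagonal matrix of the coordinates of
  the \<open>a j\<close>, so the \<open>\<ell>\<^sub>1\<close> norm of \<open>t\<close> is hardly larger than theirs, and \<open>N z\<close> is at most \<open>d / 2\<close> times the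
  \<open>\<ell>\<^sub>1\<close> norm of \<open>t\<close>.  The same matrix estimate shows that the \<open>a j\<close> are affinely independent, so that such
  coefficients exist.
\<close>

lemma norm_le_barycentric_l1:
  fixes N :: "real ^ 'n \<Rightarrow> real" and a g :: "'m::finite \<Rightarrow> real ^ 'n"
  assumes N: "is_norm N" and card: "CARD('m) = CARD('n) + 1"
    and a: "\<And>i j. N (a i - a j) \<le> d" and eps: "\<epsilon> < 1 / 2"
    and sum1: "\<And>x. (\<Sum>i\<in>UNIV. g i \<bullet> x + h i) = 1"
    and nonneg: "\<And>i j. 0 \<le> g i \<bullet> a j + h i"
    and diag: "\<And>j. 1 - \<epsilon> \<le> g j \<bullet> a j + h j"
  shows "N z \<le> d / (1 - 2 * \<epsilon>) * ((\<Sum>i\<in>UNIV. \<bar>g i \<bullet> z\<bar>) / 2)"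
proof -
  have lower: "(1 - 2 * \<epsilon>) * (\<Sum>j\<in>UNIV. \<bar>t j\<bar>) \<le> (\<Sum>i\<in>UNIV. \<bar>g i \<bullet> (\<Sum>j\<in>UNIV. t j *\<^sub>R a j)\<bar>)"
    if t: "(\<Sum>j\<in>UNIV. t j) = 0" for t
  proof -
    have "(\<Sum>j\<in>UNIV. (g i \<bullet> a j + h i) * t j) = g i \<bullet> (\<Sum>j\<in>UNIV. t j *\<^sub>R a j)" for i
    proof -
      have "(\<Sum>j\<in>UNIV. h i * t j) = 0"
        using t by (simp flip: sum_distrib_left)
      then show ?thesis
        by (simp add: algebra_simps sum.distrib inner_sum_right)
    qed
    then show ?thesis
      using stochastic_matrix_l1_lower_bound[of "\<lambda>i j. g i \<bullet> a j + h i" \<epsilon> t] nonneg sum1 diag by simp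
  qed
  obtain t where t: "(\<Sum>j\<in>UNIV. t j) = 0" "z = (\<Sum>j\<in>UNIV. t j *\<^sub>R a j)"
  proof (rule balanced_combinations_span[OF card, of a z])
    fix t assume "(\<Sum>i\<in>UNIV. t i) = 0" "(\<Sum>i\<in>UNIV. t i *\<^sub>R a i) = 0"
    then have "(1 - 2 * \<epsilon>) * (\<Sum>j\<in>UNIV. \<bar>t j\<bar>) \<le> 0"
      using lower[of t] by simp
    then have "(\<Sum>j\<in>UNIV. \<bar>t j\<bar>) \<le> 0"
      using eps by (simp add: mult_le_0_iff)
    then show "(\<Sum>i\<in>UNIV. \<bar>t i\<bar>) = 0"
      by (intro antisym sum_nonneg) auto
  qed
  have d: "0 \<le> d"
    using a[of undefined undefined] is_norm_zero[OF N] by simp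
  have "N z \<le> d / 2 * (\<Sum>i\<in>UNIV. \<bar>t i\<bar>)"
    unfolding t(2) by (rule norm_balanced_combination_le[OF N t(1) a])
  also have "(\<Sum>i\<in>UNIV. \<bar>t i\<bar>) \<le> (\<Sum>i\<in>UNIV. \<bar>g i \<bullet> z\<bar>) / (1 - 2 * \<epsilon>)"
    using lower[OF t(1)] eps by (simp add: t(2) field_simps)
  then have "d / 2 * (\<Sum>i\<in>UNIV. \<bar>t i\<bar>) \<le> d / 2 * ((\<Sum>i\<in>UNIV. \<bar>g i \<bullet> z\<bar>) / (1 - 2 * \<epsilon>))"
    using d by (intro mult_left_mono) auto
  finally show ?thesis
    by (simp add: mult_ac)
qed

text \<open>
  The total variation distance of two probability vectors is 1 minus their common mass, the sum
  of the minima of their entries.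
\<close>

lemma l1_dist_of_common_large_entry:
  fixes v w :: "'m::finite \<Rightarrow> real"
  assumes "\<And>i. 0 \<le> v i" "\<And>i. 0 \<le> w i" "(\<Sum>i\<in>UNIV. v i) = 1" "(\<Sum>i\<in>UNIV. w i) = 1"
    and "c \<le> v j" "c \<le> w j"
  shows "(\<Sum>i\<in>UNIV. \<bar>v i - w i\<bar>) / 2 \<le> 1 - c"
proof -
  have "c \<le> min (v j) (w j)"
    using assms by simp
  also have "\<dots> \<le> (\<Sum>i\<in>UNIV. min (v i) (w i))"
    using assms by (intro member_le_sum) auto
  finally have "c \<le> (\<Sum>i\<in>UNIV. min (v i) (w i))" .
  moreover have "(\<Sum>i\<in>UNIV. \<bar>v i - w i\<bar>) = (\<Sum>i\<in>UNIV. v i + w i - 2 * min (v i) (w i))"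
    by (intro sum.cong) (auto simp: min_def)
  ultimately show ?thesis
    using assms by (simp add: sum.distrib sum_subtractf flip: sum_distrib_left)
qed

section \<open>The dichotomy in dimension three\<close>

text \<open>
  Four barycentric coordinates with sum 1 include one that is at least \<open>1/4\<close>; the pieces collect the
  points for which this is the same coordinate.  The radius gives \<open>\<epsilon> = 7/57\<close>, small enough for
  \<open>(1 - 1/4) / (1 - 2 * \<epsilon>) < 1\<close>.
\<close>

lemma beta_set_le_of_no_circumscribed_ball:
  fixes N :: "real ^ 3 \<Rightarrow> real"
  assumes N: "is_norm N" and A: "A \<in> bounded_pos_diam N" and m: "4 \<le> m"
    and no_ball: "\<And>c. \<not> A \<subseteq> norm_ball N c (164 / 221 * diam N A)"
  shows "beta_set N A m \<le> 171 / 172"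
proof -
  define d where "d = diam N A"
  define r where "r = 164 / 221 * d"
  have bA: "bounded A" and d: "0 < d"
    using A by (auto simp: bounded_pos_diam_def d_def)
  have dA: "N (x - y) \<le> d" if "x \<in> A" "y \<in> A" for x y
    unfolding d_def by (rule diam_upper[OF N bA that])
  have "(\<Inter>x\<in>A. norm_ball N x r) = {}"
  proof (rule ccontr)
    assume "(\<Inter>x\<in>A. norm_ball N x r) \<noteq> {}"
    then obtain c where "\<And>x. x \<in> A \<Longrightarrow> N (c - x) \<le> r"
      unfolding norm_ball_def by blast
    then have "A \<subseteq> norm_ball N c r"
      unfolding norm_ball_def using is_norm_minus_commute[OF N] by auto
    then show False
      using no_ball by (simp add: r_def d_def)
  qed
  then obtain a :: "4 \<Rightarrow> real ^ 3" where a: "range a \<subseteq> A" "(\<Inter>i. norm_ball N (a i) r) = {}"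
    using Helly_compact_family[where 'm = 4, of A "\<lambda>x. norm_ball N x r"]
      convex_norm_ball[OF N] compact_norm_ball[OF N] by auto
  obtain g :: "4 \<Rightarrow> real ^ 3" and h
    where sum1: "\<And>x. (\<Sum>i\<in>UNIV. g i \<bullet> x + h i) = 1"
      and nonneg: "\<And>i x. x \<in> A \<Longrightarrow> 0 \<le> g i \<bullet> x + h i"
      and diag: "\<And>j. d / (d - r) - (real CARD(4) - 1) \<le> g j \<bullet> a j + h j"
    using barycentric_coordinates_of_wide_points[OF N _ _ a(2,1) dA] d
    by (auto simp: r_def)
  have ratio: "d / (d - r) = 221 / 57"
    using d by (simp add: r_def)
  have diag': "1 - 7 / 57 \<le> g j \<bullet> a j + h j" for j
    using diag[of j] unfolding ratio by simp
  \<comment> \<open>The numerals 1 to 4 exhaust the index type, so the pieces 1 to 4 cover \<open>A\<close>; the later ones repeat them.\<close>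
  define P where "P k = {x \<in> A. 1 / 4 \<le> g (of_nat k) \<bullet> x + h (of_nat k)}" for k
  show ?thesis
  proof (rule beta_set_le[OF N A, of m P])
    show "A = (\<Union>k\<in>{1..m}. P k)"
    proof
      show "A \<subseteq> (\<Union>k\<in>{1..m}. P k)"
      proof
        fix x assume x: "x \<in> A"
        have "\<exists>j. 1 / 4 \<le> g j \<bullet> x + h j"
        proof (rule ccontr)
          assume "\<not> ?thesis"
          then have "\<And>i. g i \<bullet> x + h i < 1 / 4"
            by (simp add: not_le)
          then have "(\<Sum>i\<in>UNIV. g i \<bullet> x + h i) < (\<Sum>i\<in>(UNIV :: 4 set). 1 / 4)"
            by (intro sum_strict_mono) auto
          then show False
            using sum1[of x] by simp
        qed
        then obtain j where j: "1 / 4 \<le> g j \<bullet> x + h j" ..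
        have "\<exists>k\<in>{1..4}. j = of_nat k"
          using exhaust_4[of j] by (auto intro: bexI[of _ 1] bexI[of _ 2] bexI[of _ 3] bexI[of _ 4])
        then show "x \<in> (\<Union>k\<in>{1..m}. P k)"
          using x j m by (fastforce simp: P_def)
      qed
    qed (auto simp: P_def)
    fix k x y assume xy: "x \<in> P k" "y \<in> P k"
    have "N (x - y) \<le> d / (1 - 2 * (7 / 57)) * ((\<Sum>i\<in>UNIV. \<bar>g i \<bullet> (x - y)\<bar>) / 2)"
      using a(1) by (intro norm_le_barycentric_l1[OF N _ _ _ sum1 _ diag'] dA nonneg) auto
    also have "\<dots> \<le> d / (1 - 2 * (7 / 57)) * (1 - 1 / 4)"
    proof (rule mult_left_mono)
      show "(\<Sum>i\<in>UNIV. \<bar>g i \<bullet> (x - y)\<bar>) / 2 \<le> 1 - 1 / 4"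
        using l1_dist_of_common_large_entry[of "\<lambda>i. g i \<bullet> x + h i" "\<lambda>i. g i \<bullet> y + h i" "1 / 4" "of_nat k"]
          xy nonneg sum1 by (simp add: P_def inner_diff_right)
    qed (use d in simp)
    finally show "N (x - y) \<le> 171 / 172 * diam N A"
      by (simp add: d_def)
  qed (use m in auto)
qed

theorem corollary13:
  fixes N :: "real ^ 3 \<Rightarrow> real"
  assumes "is_norm N"
    and "beta_set N (unit_ball N) 8 < 221 / 328"
  shows "beta N 8 < 1"
proof -
  note N = assms(1)
  have ball: "unit_ball N \<in> bounded_pos_diam N" "diam N (unit_ball N) \<le> 2"
    using unit_ball_bounded_pos_diam[OF N] by auto
  obtain P :: "nat \<Rightarrow> (real ^ 3) set" and q where q: "0 \<le> q" "q < 221 / 328" and cover: "unit_ball N = (\<Union>k\<in>{1..8}. P k)"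
    and small: "\<And>k x y. k \<in> {1..8} \<Longrightarrow> x \<in> P k \<Longrightarrow> y \<in> P k \<Longrightarrow> N (x - y) \<le> q * diam N (unit_ball N)"
    using beta_set_less_cover[OF N ball(1) _ assms(2)] by (metis one_le_numeral)
  have small': "N (x - y) \<le> 2 * q" if "k \<in> {1..8}" "x \<in> P k" "y \<in> P k" for k x y
    using small[OF that] mult_left_mono[OF ball(2) q(1)] by linarith
  let ?b = "max (2 * (164 / 221) * q) (171 / 172)"
  have "beta_set N A 8 \<le> ?b" if A: "A \<in> bounded_pos_diam N" for A
  proof (cases "\<exists>c. A \<subseteq> norm_ball N c (164 / 221 * diam N A)")
    case True
    then obtain c where "A \<subseteq> norm_ball N c (164 / 221 * diam N A)" by blast
    then have "beta_set N A 8 \<le> 2 * (164 / 221) * q"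
      by (intro beta_set_le_of_circumscribed_ball[OF N A _ q(1) cover small']) auto
    then show ?thesis by simp
  next
    case False
    then have "beta_set N A 8 \<le> 171 / 172"
      by (intro beta_set_le_of_no_circumscribed_ball[OF N A]) auto
    then show ?thesis by simp
  qed
  then have "beta N 8 \<le> ?b"
    unfolding beta_def using ball(1) by (intro cSup_least) auto
  also have "\<dots> < 1"
    using q(2) by simp
  finally show ?thesis .
qed

end
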